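(* For every positive integer $n$, there is exactly one ballot permutation of length $n$ avoiding both patterns $123$ and $132$, i.e. $|B_n(123,132)|=1$.
   Context: A permutation $\sigma\in S_n$ is written as $\sigma(1)\cdots\sigma(n)$. An index $i\in[n-1]$ is an ascent if $\sigma(i)<\sigma(i+1)$ and a descent if $\sigma(i)>\sigma(i+1)$. A ballot permutation is a permutation such that every prefix $\sigma(1)\cdots\sigma(p)$ has at least as many ascents as descents. $\sigma$ contains a pattern $\pi\in S_k$ if some subsequence $\sigma(c_1)\cdots\sigma(c_k)$ with $c_1<\dots<c_k$ is order-isomorphic to $\pi$, and avoids $\pi$ otherwise. $B_n(\pi_1,\dots,\pi_m)$ denotes the set of ballot permutations of length $n$ avoiding all of $\pi_1,\dots,\pi_m$. *)

theory Defs
  imports Main "HOL-Combinatorics.Multiset_Permutations" "HOL-Library.Sublist"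
begin

text \<open>
  A permutation in \<open>S\<^sub>n\<close> is represented by its one-line notation
  \<open>[\<sigma>(1), \<dots>, \<sigma>(n)]\<close>, i.e. by an element of \<^term>\<open>permutations_of_set {1..n}\<close>.
  List positions start at 0, so the ascents and descents below are those
  of the paper shifted down by one.
\<close>

definition ascents :: "nat list \<Rightarrow> nat set" where
  "ascents w = {i. Suc i < length w \<and> w ! i < w ! Suc i}"

definition descents :: "nat list \<Rightarrow> nat set" where
  "descents w = {i. Suc i < length w \<and> w ! i > w ! Suc i}"

definition ballot :: "nat list \<Rightarrow> bool" where
  "ballot w \<longleftrightarrow> (\<forall>p \<le> length w. card (descents (take p w)) \<le> card (ascents (take p w)))"

definition order_isomorphic :: "nat list \<Rightarrow> nat list \<Rightarrow> bool" where
  "order_isomorphic u v \<longleftrightarrow> length u = length v \<and>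
     (\<forall>i < length u. \<forall>j < length u. u ! i < u ! j \<longleftrightarrow> v ! i < v ! j)"

definition contains_pattern :: "nat list \<Rightarrow> nat list \<Rightarrow> bool" where
  "contains_pattern w \<pi> \<longleftrightarrow> (\<exists>u. subseq u w \<and> order_isomorphic u \<pi>)"

definition ballot_avoiders :: "nat \<Rightarrow> nat list set \<Rightarrow> nat list set" where
  "ballot_avoiders n P =
     {w \<in> permutations_of_set {1..n}. ballot w \<and> (\<forall>\<pi> \<in> P. \<not> contains_pattern w \<pi>)}"

end

theory Submission imports Defs begin

text \<open>
  Avoiding 123 and 132 means that no entry has two larger entries to its right, so the
  first entry is at least \<open>n - 1\<close>. A ballot permutation starts with an ascent, hence with
  \<open>n - 1, n\<close>. The next step is a descent, which cancels this ascent, so the rest is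
  again a ballot permutation avoiding both patterns, of length \<open>n - 2\<close>.
\<close>

text \<open>The only candidate for a ballot avoider: the top two values in increasing order, then
  the next two, and so on down. For odd \<open>n\<close> the word ends in the unpaired entry
  1.\<close>

fun pair_descending :: "nat \<Rightarrow> nat list" where
  "pair_descending 0 = []"
| "pair_descending (Suc 0) = [1]"
| "pair_descending (Suc (Suc n)) = Suc n # Suc (Suc n) # pair_descending n"

lemma distinct_pair_descending: "distinct (pair_descending n)"
  and set_pair_descending: "set (pair_descending n) = {1..n}"
  by (induction n rule: pair_descending.induct) auto

lemma ascents_short [simp]: "ascents [] = {}" "ascents [x] = {}"
  and descents_short [simp]: "descents [] = {}" "descents [x] = {}"
  by (auto simp: ascents_def descents_def)

lemma finite_ascents: "finite (ascents w)"
  by (rule finite_subset[of _ "{..<length w}"]) (auto simp: ascents_def)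

lemma finite_descents: "finite (descents w)"
  by (rule finite_subset[of _ "{..<length w}"]) (auto simp: descents_def)

text \<open>Prepending \<open>x\<close> shifts every ascent of \<open>y # w\<close> by one position,
  and the new position 0 is an ascent precisely when \<open>x < y\<close>.\<close>

lemma card_ascents_Cons_Cons:
  "card (ascents (x # y # w)) = of_bool (x < y) + card (ascents (y # w))"
proof -
  have "ascents (x # y # w) = (if x < y then {0} else {}) \<union> Suc ` ascents (y # w)"
  proof (rule set_eqI)
    show "i \<in> ascents (x # y # w) \<longleftrightarrow>
        i \<in> (if x < y then {0} else {}) \<union> Suc ` ascents (y # w)" for i
      by (cases i) (auto simp: ascents_def)
  qed
  then show ?thesis
    by (simp add: finite_ascents card_image card_insert_if)
qed

lemma card_descents_Cons_Cons:
  "card (descents (x # y # w)) = of_bool (x > y) + card (descents (y # w))"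
proof -
  have "descents (x # y # w) = (if x > y then {0} else {}) \<union> Suc ` descents (y # w)"
  proof (rule set_eqI)
    show "i \<in> descents (x # y # w) \<longleftrightarrow>
        i \<in> (if x > y then {0} else {}) \<union> Suc ` descents (y # w)" for i
      by (cases i) (auto simp: descents_def)
  qed
  then show ?thesis
    by (simp add: finite_descents card_image card_insert_if)
qed

text \<open>The ascent from \<open>x\<close> to \<open>y\<close> is cancelled by the descent from
  \<open>y\<close> to the first entry of \<open>w\<close>. A nonempty prefix of \<open>w\<close>
  therefore gains one ascent and one descent when \<open>x\<close> and \<open>y\<close> are put in
  front of it, and the comparison of the counts does not change.\<close>

lemma ballot_Cons_Cons_ascent:
  assumes "x < y" and "\<And>z. z \<in> set w \<Longrightarrow> z < y"
  shows "ballot (x # y # w) \<longleftrightarrow> ballot w"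
proof -
  have step: "card (descents (take (Suc (Suc p)) (x # y # w)))
      \<le> card (ascents (take (Suc (Suc p)) (x # y # w)))
      \<longleftrightarrow> card (descents (take p w)) \<le> card (ascents (take p w))" for p
  proof (cases "take p w")
    case Nil
    then show ?thesis
      \<comment> \<open>The prefix is \<open>[x, y]\<close>, with one ascent and no descent, so both
        sides hold. Deleting the two rules keeps \<open>take p w = []\<close> as a rewrite rule
        instead of splitting it into a disjunction.\<close>
      using assms by (simp add: card_ascents_Cons_Cons card_descents_Cons_Cons del: take_eq_Nil take_eq_Nil2)
  next
    case (Cons z v)
    then have "z \<in> set w"
      by (metis in_set_takeD list.set_intros(1))
    with Cons show ?thesis
      using assms by (auto simp: card_ascents_Cons_Cons card_descents_Cons_Cons dest: less_imp_not_less)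
  qed
  have short: "card (descents (take p (x # y # w))) \<le> card (ascents (take p (x # y # w)))"
    if "p < 2" for p
    using that by (cases p) auto
  show ?thesis
    unfolding ballot_def
  proof (intro iffI allI impI)
    fix p assume *: "\<forall>p\<le>length (x # y # w).
        card (descents (take p (x # y # w))) \<le> card (ascents (take p (x # y # w)))"
      and "p \<le> length w"
    then show "card (descents (take p w)) \<le> card (ascents (take p w))"
      using *[rule_format, of "Suc (Suc p)"] step[of p] by simp
  next
    fix p assume *: "\<forall>p\<le>length w. card (descents (take p w)) \<le> card (ascents (take p w))"
      and p: "p \<le> length (x # y # w)"
    show "card (descents (take p (x # y # w))) \<le> card (ascents (take p (x # y # w)))"
    proof (cases "p < 2")
      case False
      then obtain q where "p = Suc (Suc q)"
        by (metis add_2_eq_Suc le_Suc_ex not_less)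
      then show ?thesis
        using * p step[of q] by simp
    qed (rule short)
  qed
qed

text \<open>Merges the patterns 123 and 132: in both, the smallest entry comes first, and they
  differ only in the order of the other two, which is left open here.\<close>

definition two_larger_right :: "nat list \<Rightarrow> bool" where
  "two_larger_right w \<longleftrightarrow> (\<exists>x y z. subseq [x, y, z] w \<and> x < y \<and> x < z)"

lemma order_isomorphic_123:
  "order_isomorphic u [1, 2, 3] \<longleftrightarrow> (\<exists>x y z. u = [x, y, z] \<and> x < y \<and> y < z)"
proof
  assume *: "order_isomorphic u [1, 2, 3]"
  then have "length u = 3" by (simp add: order_isomorphic_def)
  then obtain x y z where u: "u = [x, y, z]"
    by (auto simp: numeral_3_eq_3 length_Suc_conv)
  with * show "\<exists>x y z. u = [x, y, z] \<and> x < y \<and> y < z"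
    by (simp add: order_isomorphic_def All_less_Suc numeral_3_eq_3)
qed (auto simp: order_isomorphic_def less_Suc_eq)

lemma order_isomorphic_132:
  "order_isomorphic u [1, 3, 2] \<longleftrightarrow> (\<exists>x y z. u = [x, y, z] \<and> x < z \<and> z < y)"
proof
  assume *: "order_isomorphic u [1, 3, 2]"
  then have "length u = 3" by (simp add: order_isomorphic_def)
  then obtain x y z where u: "u = [x, y, z]"
    by (auto simp: numeral_3_eq_3 length_Suc_conv)
  with * show "\<exists>x y z. u = [x, y, z] \<and> x < z \<and> z < y"
    by (simp add: order_isomorphic_def All_less_Suc numeral_3_eq_3)
qed (auto simp: order_isomorphic_def less_Suc_eq)

lemma subseq_distinct:
  assumes "subseq u w" and "distinct w"
  shows "distinct u"
  using assms by (metis subseq_conv_nths distinct_nthsI)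

text \<open>Since the entries are distinct, the two larger ones satisfy \<open>y < z\<close> or
  \<open>z < y\<close>; the first case is an occurrence of 123, the second one of 132.\<close>

lemma avoids_123_132_iff:
  assumes "distinct w"
  shows "(\<forall>\<pi> \<in> {[1, 2, 3], [1, 3, 2]}. \<not> contains_pattern w \<pi>) \<longleftrightarrow> \<not> two_larger_right w"
proof -
  have "y \<noteq> z" if "subseq [x, y, z] w" for x y z
    using subseq_distinct[OF that assms] by simp
  moreover have "contains_pattern w [1, 2, 3] \<longleftrightarrow>
      (\<exists>x y z. subseq [x, y, z] w \<and> x < y \<and> y < z)"
    unfolding contains_pattern_def order_isomorphic_123 by blast
  moreover have "contains_pattern w [1, 3, 2] \<longleftrightarrow>
      (\<exists>x y z. subseq [x, y, z] w \<and> x < z \<and> z < y)"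
    unfolding contains_pattern_def order_isomorphic_132 by blast
  ultimately show ?thesis
    unfolding two_larger_right_def by (simp; meson less_trans linorder_neqE_nat)
qed

lemma two_larger_right_Cons:
  "two_larger_right (a # w) \<longleftrightarrow>
     two_larger_right w \<or> (\<exists>y z. subseq [y, z] w \<and> a < y \<and> a < z)"
proof -
  have "subseq [x, y, z] (a # w) \<longleftrightarrow> subseq [x, y, z] w \<or> x = a \<and> subseq [y, z] w" for x y z
    using subseq_Cons'[of x "[y, z]" w] by auto
  then show ?thesis
    unfolding two_larger_right_def by blast
qed

lemma subseq_set_subset: "subseq u w \<Longrightarrow> set u \<subseteq> set w"
  by (metis subseq_conv_nths set_nths_subset)

text \<open>Serves to find two larger entries to the right of a given one when the order in which
  they appear is unknown.\<close>

lemma subseq_pair_or_swap: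
  assumes "x \<in> set w" "y \<in> set w" "x \<noteq> y"
  shows "subseq [x, y] w \<or> subseq [y, x] w"
  using assms by (induction w) (auto simp: subseq_singleton_left)

lemma two_larger_right_pair_descending: "\<not> two_larger_right (pair_descending n)"
proof (induction n rule: pair_descending.induct)
  case (3 n)
  \<comment> \<open>Only \<open>Suc (Suc n)\<close> exceeds \<open>Suc n\<close> in this list, and
    it occurs once, so \<open>y\<close> and \<open>z\<close> cannot both be larger.\<close>
  have "False" if "subseq [y, z] (Suc (Suc n) # pair_descending n)" "Suc n < y" "Suc n < z" for y z
  proof -
    have "distinct [y, z]"
      using distinct_pair_descending[of n]
      by (intro subseq_distinct[OF that(1)]) (simp add: set_pair_descending)
    moreover have "y \<in> set (Suc (Suc n) # pair_descending n)"
        "z \<in> set (Suc (Suc n) # pair_descending n)"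
      using subseq_set_subset[OF that(1)] by auto
    ultimately show False
      using that(2,3) by (auto simp: set_pair_descending)
  qed
  moreover have "False" if "subseq [y, z] (pair_descending n)" "Suc (Suc n) < y" for y z
    using subseq_set_subset[OF that(1)] that(2) by (auto simp: set_pair_descending)
  ultimately show ?case
    using 3 by (auto simp only: pair_descending.simps two_larger_right_Cons)
qed (auto simp: two_larger_right_def)

lemma ballot_pair_descending: "ballot (pair_descending n)"
proof (induction n rule: pair_descending.induct)
  case (3 n)
  then show ?case
    using ballot_Cons_Cons_ascent[of "Suc n" "Suc (Suc n)" "pair_descending n"]
    by (simp add: set_pair_descending)
qed (auto simp: ballot_def take_Cons' )

text \<open>The induction goes down by two: the first two entries are forced to be the two largest
  values in increasing order, and the remaining word satisfies the same hypotheses for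
  \<open>n\<close>.\<close>

lemma ballot_avoiding_unique:
  assumes "distinct w" "set w = {1..n}" "ballot w" "\<not> two_larger_right w"
  shows "w = pair_descending n"
  using assms
proof (induction n arbitrary: w rule: pair_descending.induct)
  case 1
  then show ?case by simp
next
  case 2
  then have "length w = 1"
    using distinct_card[of w] by simp
  then obtain x where "w = [x]"
    by (cases w) auto
  with 2 show ?case by simp
next
  case (3 n)
  have "length w = Suc (Suc n)"
    using distinct_card[of w] "3.prems"(1,2) by simp
  then obtain a b v where w: "w = a # b # v"
    by (metis Suc_length_conv)
  \<comment> \<open>A descent at the start would give the prefix of length 2 one descent and no
    ascent.\<close>
  have "\<not> b < a"
    using "3.prems"(3)[unfolded ballot_def, rule_format, of 2]
    by (auto simp: w card_ascents_Cons_Cons card_descents_Cons_Cons)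
  then have "a < b"
    using "3.prems"(1) w by auto
  \<comment> \<open>Otherwise the two largest values both stand to the right of the smaller entry
    \<open>a\<close>, in one order or the other.\<close>
  have "Suc n \<le> a"
  proof (rule ccontr)
    assume "\<not> Suc n \<le> a"
    moreover have "Suc n \<in> set w" "Suc (Suc n) \<in> set w"
      using "3.prems"(2) by auto
    ultimately have "Suc n \<in> set (b # v)" "Suc (Suc n) \<in> set (b # v)"
      using w by auto
    then have "subseq [Suc n, Suc (Suc n)] (b # v) \<or> subseq [Suc (Suc n), Suc n] (b # v)"
      by (rule subseq_pair_or_swap) simp
    with \<open>\<not> Suc n \<le> a\<close> have "two_larger_right w"
      unfolding w two_larger_right_Cons[of a] by (meson less_SucI not_le)
    with "3.prems"(4) show False by simp
  qed
  moreover have "b \<le> Suc (Suc n)"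
    using "3.prems"(2) w by auto
  ultimately have ab: "a = Suc n" "b = Suc (Suc n)"
    using \<open>a < b\<close> by auto
  have "set v = {1..Suc (Suc n)} - {a, b}"
    using "3.prems"(1,2) w by auto
  also have "\<dots> = {1..n}"
    unfolding ab by auto
  finally have v: "set v = {1..n}" .
  \<comment> \<open>All entries of \<open>v\<close> are at most \<open>n\<close>, hence below
    \<open>b\<close>, so the leading pair can be removed.\<close>
  have "ballot v"
    using "3.prems"(3) ballot_Cons_Cons_ascent[OF \<open>a < b\<close>, of v] unfolding w v ab by simp
  moreover have "\<not> two_larger_right v"
    using "3.prems"(4) by (simp add: w two_larger_right_Cons)
  moreover have "distinct v"
    using "3.prems"(1) w by simp
  ultimately have "v = pair_descending n"
    using "3.IH" v by blast
  with w ab show ?case by simp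
qed

theorem theorem3p2:
  fixes n :: nat
  assumes "n \<ge> 1"
  shows "card (ballot_avoiders n {[1, 2, 3], [1, 3, 2]}) = 1"
proof -
  have "ballot_avoiders n {[1, 2, 3], [1, 3, 2]} = {pair_descending n}"
  proof (intro equalityI subsetI)
    fix w assume w: "w \<in> ballot_avoiders n {[1, 2, 3], [1, 3, 2]}"
    then have "distinct w" "set w = {1..n}" "ballot w"
      by (auto simp: ballot_avoiders_def permutations_of_set_def)
    moreover have "\<not> two_larger_right w"
      using w avoids_123_132_iff[OF \<open>distinct w\<close>] by (simp add: ballot_avoiders_def)
    ultimately show "w \<in> {pair_descending n}"
      using ballot_avoiding_unique by simp
  next
    fix w assume "w \<in> {pair_descending n}"
    then show "w \<in> ballot_avoiders n {[1, 2, 3], [1, 3, 2]}"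
      using avoids_123_132_iff[OF distinct_pair_descending, of n]
      by (simp add: ballot_avoiders_def permutations_of_set_def distinct_pair_descending
          set_pair_descending ballot_pair_descending two_larger_right_pair_descending)
  qed
  then show ?thesis by simp
qed

end
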